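(* Let $\mathcal{L}$ be a finite semidistributive lattice with at least two atoms and at least two coatoms, and let $\mathcal{M}$ be a maximal sublattice of $\mathcal{L}$ with complement $\mathcal{C}=\mathcal{L}\setminus\mathcal{M}$. If $\mathcal{C}$ has a greatest element or a least element, or if $\mathcal{C}$ contains an atom or a coatom of $\mathcal{L}$, then $\mathcal{C}$ is an interval of $\mathcal{L}$.
   Context: A lattice is join-semidistributive if $x\vee y=x\vee z$ implies $x\vee(y\wedge z)=x\vee y$ for all $x,y,z$; meet-semidistributive is the dual condition; semidistributive means both. A maximal sublattice is a proper (nonempty) sublattice not contained in any other proper sublattice. An interval is a set of the form $[a,b]=\{c: a\le c\le b\}$. Atoms are the covers of the least element, coatoms the subcovers of the greatest element. *)

theory Defs
  imports Main
begin

definition join_semidistributive :: "'a::lattice itself \<Rightarrow> bool" where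
  "join_semidistributive _ \<longleftrightarrow>
     (\<forall>x y z :: 'a. sup x y = sup x z \<longrightarrow> sup x (inf y z) = sup x y)"

definition meet_semidistributive :: "'a::lattice itself \<Rightarrow> bool" where
  "meet_semidistributive _ \<longleftrightarrow>
     (\<forall>x y z :: 'a. inf x y = inf x z \<longrightarrow> inf x (sup y z) = inf x y)"

definition semidistributive :: "'a::lattice itself \<Rightarrow> bool" where
  "semidistributive T \<longleftrightarrow> join_semidistributive T \<and> meet_semidistributive T"

definition covers :: "'a::order \<Rightarrow> 'a \<Rightarrow> bool" where
  "covers y x \<longleftrightarrow> x < y \<and> (\<nexists>z. x < z \<and> z < y)"

definition atoms :: "'a::order_bot set" where
  "atoms = {a. covers a bot}"

definition coatoms :: "'a::order_top set" where
  "coatoms = {a. covers top a}"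

(* Closed under binary meet and join only: a sublattice need not contain the
   least or greatest element of the lattice. *)
definition sublattice :: "'a::lattice set \<Rightarrow> bool" where
  "sublattice S \<longleftrightarrow> S \<noteq> {} \<and> (\<forall>x\<in>S. \<forall>y\<in>S. inf x y \<in> S \<and> sup x y \<in> S)"

definition proper_sublattice :: "'a::lattice set \<Rightarrow> bool" where
  "proper_sublattice S \<longleftrightarrow> sublattice S \<and> S \<noteq> UNIV"

definition maximal_sublattice :: "'a::lattice set \<Rightarrow> bool" where
  "maximal_sublattice M \<longleftrightarrow>
     proper_sublattice M \<and> (\<forall>S. proper_sublattice S \<and> M \<subseteq> S \<longrightarrow> S = M)"

definition has_greatest :: "'a::order set \<Rightarrow> bool" where
  "has_greatest A \<longleftrightarrow> (\<exists>g\<in>A. \<forall>x\<in>A. x \<le> g)"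

definition has_least :: "'a::order set \<Rightarrow> bool" where
  "has_least A \<longleftrightarrow> (\<exists>l\<in>A. \<forall>x\<in>A. l \<le> x)"

definition is_interval :: "'a::order set \<Rightarrow> bool" where
  "is_interval A \<longleftrightarrow> (\<exists>a b. a \<le> b \<and> A = {a..b})"

end

(* If C has a least element l, let d be the least element of M above l. Both M \<union> {x. d \<le> x} and
   M \<union> {x. e \<le> x} for l < e < d are sublattices missing l, so maximality forces C to be the set of
   x \<ge> l with x \<not>\<ge> d and d to cover l. Thus C = {x. x \<sqinter> d = l}, which is closed under joins by meet
   semidistributivity and hence has a greatest element.
   If C contains an atom a, meet semidistributivity makes a join prime. With g the least element of
   M above a, the set of x with x \<ge> g or x \<not>\<ge> a is a sublattice missing a and containing M, so it
   equals M and a is the least element of C. The remaining cases are dual. *)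

theory Submission
  imports Defs
begin

text \<open>Finiteness gives a minimal element \<open>g\<close>; for \<open>x\<close> in
  \<open>A\<close> the meet of \<open>g\<close> and \<open>x\<close> is in \<open>A\<close> below
  \<open>g\<close>, hence equal to \<open>g\<close>. Living in \<open>semilattice_inf\<close>, the
  lemma also serves joins through \<open>dual_semilattice\<close>.\<close>

lemma (in semilattice_inf) finite_inf_closed_has_least:
  assumes "finite A" "A \<noteq> {}" "\<And>x y. x \<in> A \<Longrightarrow> y \<in> A \<Longrightarrow> inf x y \<in> A"
  obtains g where "g \<in> A" "\<And>x. x \<in> A \<Longrightarrow> g \<le> x"
proof -
  obtain g where g: "g \<in> A" "\<And>b. b \<in> A \<Longrightarrow> b \<le> g \<Longrightarrow> g = b"
    using finite_has_minimal[OF assms(1,2)] by blast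
  have "g \<le> x" if "x \<in> A" for x
    using g(2)[OF assms(3)[OF g(1) that] inf_le1] by (metis inf_le2)
  with g(1) show thesis by (rule that)
qed

text \<open>The order is a parameter, so that \<open>dual\<close> can instantiate the locale at the
  reversed order and every lemma below comes with its dual. In \<open>maximal\<close>, the missing
  point \<open>z\<close> expresses that \<open>S\<close> is proper.\<close>

locale finite_maximal_sublattice = lattice inf less_eq less sup
  for inf :: "'a \<Rightarrow> 'a \<Rightarrow> 'a" (infixl "\<sqinter>" 70)
    and less_eq (infix "\<sqsubseteq>" 50) and less (infix "\<sqsubset>" 50)
    and sup (infixl "\<squnion>" 65) +
  fixes M :: "'a set"
  assumes fin: "finite (UNIV :: 'a set)"
    and inf_closed: "x \<in> M \<Longrightarrow> y \<in> M \<Longrightarrow> x \<sqinter> y \<in> M"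
    and sup_closed: "x \<in> M \<Longrightarrow> y \<in> M \<Longrightarrow> x \<squnion> y \<in> M"
    and maximal: "M \<subseteq> S \<Longrightarrow> (\<And>x y. x \<in> S \<Longrightarrow> y \<in> S \<Longrightarrow> x \<sqinter> y \<in> S) \<Longrightarrow>
      (\<And>x y. x \<in> S \<Longrightarrow> y \<in> S \<Longrightarrow> x \<squnion> y \<in> S) \<Longrightarrow> z \<notin> S \<Longrightarrow> S = M"
begin

lemma dual: "finite_maximal_sublattice (\<squnion>) (\<lambda>x y. y \<sqsubseteq> x) (\<lambda>x y. y \<sqsubset> x) (\<sqinter>) M"
proof (intro finite_maximal_sublattice.intro dual_lattice finite_maximal_sublattice_axioms.intro)
  show "S = M" if "M \<subseteq> S" "\<And>x y. x \<in> S \<Longrightarrow> y \<in> S \<Longrightarrow> x \<squnion> y \<in> S"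
    "\<And>x y. x \<in> S \<Longrightarrow> y \<in> S \<Longrightarrow> x \<sqinter> y \<in> S" "z \<notin> S" for S z
    using that(1,3,2,4) by (rule maximal)
qed (use fin inf_closed sup_closed in auto)

text \<open>Adjoining a greatest element to a sublattice gives a sublattice. If \<open>t\<close>
  were outside \<open>M\<close>, maximality would leave \<open>t\<close> as the only point outside,
  so \<open>c\<close> and \<open>d\<close> would be in \<open>M\<close>, and with them their join
  \<open>t\<close>.\<close>

lemma sup_reducible_top_mem:
  assumes top: "\<And>x. x \<sqsubseteq> t" and "c \<noteq> t" "d \<noteq> t" "c \<squnion> d = t"
  shows "t \<in> M"
proof (rule ccontr)
  assume t: "t \<notin> M"
  have "z \<in> insert t M" for z
  proof (rule ccontr)
    assume "z \<notin> insert t M"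
    then have "insert t M = M"
      by (intro maximal)
        (use inf_closed sup_closed top in \<open>auto simp: inf_absorb1 inf_absorb2 sup_absorb1 sup_absorb2\<close>)
    with t show False by blast
  qed
  then have "c \<in> M" "d \<in> M" using assms(2,3) by auto
  with sup_closed assms(4) t show False by blast
qed

text \<open>The element \<open>m\<close> guarantees that \<open>M\<close> has elements above
  \<open>l\<close>; the final theorem takes it to be \<open>top\<close>, or dually
  \<open>bot\<close>.\<close>

lemma least_mem_above:
  assumes "m \<in> M" "l \<sqsubseteq> m"
  obtains d where "d \<in> M" "l \<sqsubseteq> d" "\<And>x. x \<in> M \<Longrightarrow> l \<sqsubseteq> x \<Longrightarrow> d \<sqsubseteq> x"
proof -
  have "finite {x \<in> M. l \<sqsubseteq> x}" "{x \<in> M. l \<sqsubseteq> x} \<noteq> {}"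
    using fin assms by (auto intro: finite_subset)
  then obtain d where "d \<in> {x \<in> M. l \<sqsubseteq> x}" "\<And>x. x \<in> {x \<in> M. l \<sqsubseteq> x} \<Longrightarrow> d \<sqsubseteq> x"
    by (rule finite_inf_closed_has_least) (auto intro: inf_closed)
  with that show thesis by auto
qed

lemma complement_with_least_is_interval:
  assumes msd: "\<And>x y z. x \<sqinter> y = x \<sqinter> z \<Longrightarrow> x \<sqinter> (y \<squnion> z) = x \<sqinter> y"
    and l: "l \<notin> M" "\<And>x. x \<notin> M \<Longrightarrow> l \<sqsubseteq> x"
    and m: "m \<in> M" "l \<sqsubseteq> m"
  shows "\<exists>b. l \<sqsubseteq> b \<and> UNIV - M = {x. l \<sqsubseteq> x \<and> x \<sqsubseteq> b}"
proof -
  obtain d where d: "d \<in> M" "l \<sqsubseteq> d" and least: "\<And>x. x \<in> M \<Longrightarrow> l \<sqsubseteq> x \<Longrightarrow> d \<sqsubseteq> x"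
    using least_mem_above[OF m] by metis
  \<comment> \<open>Used twice: for an arbitrary \<open>e\<close> to get \<open>cover\<close>, and
    for \<open>e = d\<close> to keep elements above \<open>d\<close> out of the complement.\<close>
  have above: "x \<in> M" if e: "l \<sqsubseteq> e" "e \<sqsubseteq> d" "e \<noteq> l" and x: "e \<sqsubseteq> x" for e x
  proof -
    have inf_mem: "y \<sqinter> z \<in> M \<union> {x. e \<sqsubseteq> x}" if "y \<in> M" "e \<sqsubseteq> z" for y z
    proof (cases "l \<sqsubseteq> y")
      case True
      then have "e \<sqsubseteq> y" using least[OF that(1)] e(2) by (blast intro: order_trans)
      with that show ?thesis by simp
    next
      \<comment> \<open>A meet that is not above \<open>l\<close> is in \<open>M\<close>, because
        \<open>l\<close> lies below the whole complement.\<close>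
      case False
      then have "\<not> l \<sqsubseteq> y \<sqinter> z" by simp
      with l(2) show ?thesis by blast
    qed
    have "M \<union> {x. e \<sqsubseteq> x} = M"
    proof (rule maximal)
      show "y \<sqinter> z \<in> M \<union> {x. e \<sqsubseteq> x}" if "y \<in> M \<union> {x. e \<sqsubseteq> x}" "z \<in> M \<union> {x. e \<sqsubseteq> x}" for y z
        using that inf_closed inf_mem[of y z] inf_mem[of z y] by (auto simp: inf_commute)
      show "y \<squnion> z \<in> M \<union> {x. e \<sqsubseteq> x}" if "y \<in> M \<union> {x. e \<sqsubseteq> x}" "z \<in> M \<union> {x. e \<sqsubseteq> x}" for y z
        using that sup_closed by (auto intro: le_supI1 le_supI2)
      show "l \<notin> M \<union> {x. e \<sqsubseteq> x}" using l(1) e by (auto intro: order.antisym)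
    qed simp
    with x show ?thesis by blast
  qed
  \<comment> \<open>Otherwise \<open>above\<close> puts \<open>e\<close> itself into
    \<open>M\<close>, and leastness of \<open>d\<close> gives \<open>e = d\<close>.\<close>
  have cover: "e = l" if "l \<sqsubseteq> e" "e \<sqsubseteq> d" "e \<noteq> d" for e
    using above[OF that(1,2), of e] least[of e] that by (auto intro: order.antisym)
  have C: "UNIV - M = {x. d \<sqinter> x = l}"
  proof (intro set_eqI iffI)
    fix x
    assume "x \<in> UNIV - M"
    then have x: "x \<notin> M" by blast
    have "d \<sqinter> x = l"
    proof (rule cover)
      show "l \<sqsubseteq> d \<sqinter> x" using d(2) l(2)[OF x] by simp
      have "d \<noteq> l" using d(1) l(1) by blast
      then show "d \<sqinter> x \<noteq> d"
        using above[OF d(2) order.refl, of x] x by (auto simp: le_iff_inf)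
    qed simp
    then show "x \<in> {x. d \<sqinter> x = l}" by simp
  next
    fix x
    assume "x \<in> {x. d \<sqinter> x = l}"
    with inf_closed[OF d(1), of x] l(1) show "x \<in> UNIV - M" by auto
  qed
  have "finite (UNIV - M)" "UNIV - M \<noteq> {}" using fin l(1) by (auto intro: finite_subset)
  \<comment> \<open>In the form given by \<open>C\<close>, closure under joins is the instance of
    \<open>msd\<close> at \<open>d\<close>.\<close>
  then obtain b where b: "b \<in> UNIV - M" "\<And>x. x \<in> UNIV - M \<Longrightarrow> x \<sqsubseteq> b"
    unfolding C
    by (rule semilattice_inf.finite_inf_closed_has_least[OF dual_semilattice])
      (use msd in auto)
  have "x \<in> UNIV - M" if "l \<sqsubseteq> x" "x \<sqsubseteq> b" for x
  proof -
    have "d \<sqinter> x \<sqsubseteq> d \<sqinter> b" using that(2) by (simp add: le_infI2)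
    also have "\<dots> = l" using b(1) C by blast
    finally show ?thesis unfolding C using that(1) d(2) by (auto intro: order.antisym)
  qed
  with b l(2) show ?thesis by blast
qed

lemma atom_outside_is_least:
  assumes msd: "\<And>x y z. x \<sqinter> y = x \<sqinter> z \<Longrightarrow> x \<sqinter> (y \<squnion> z) = x \<sqinter> y"
    and bot: "\<And>x. z \<sqsubseteq> x" "z \<noteq> a" and atom: "\<And>x. x \<sqsubseteq> a \<Longrightarrow> x = z \<or> x = a"
    and a: "a \<notin> M" and m: "m \<in> M" "a \<sqsubseteq> m"
    and x: "x \<notin> M"
  shows "a \<sqsubseteq> x"
proof -
  obtain g where g: "g \<in> M" "a \<sqsubseteq> g" and least: "\<And>x. x \<in> M \<Longrightarrow> a \<sqsubseteq> x \<Longrightarrow> g \<sqsubseteq> x"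
    using least_mem_above[OF m] by metis
  have above: "a \<sqsubseteq> x \<longleftrightarrow> a \<sqinter> x \<noteq> z" for x
    using atom[OF inf_le1, of x] bot(2) inf_absorb1[of a x] inf_le2[of a x] by metis
  \<comment> \<open>If \<open>a\<close> is below neither, both meets with \<open>a\<close> are the
    bottom \<open>z\<close>, and \<open>msd\<close> makes the meet of \<open>a\<close> with the join
    equal to \<open>z\<close> too.\<close>
  have prime: "a \<sqsubseteq> x \<or> a \<sqsubseteq> y" if "a \<sqsubseteq> x \<squnion> y" for x y
    using msd[of a x y] that by (auto simp: above)
  \<comment> \<open>Every point outside this set is above \<open>a\<close>, so it suffices that the
    set equals \<open>M\<close>. Primeness of \<open>a\<close> is what closes it under
    joins.\<close>
  let ?S = "{x. a \<sqsubseteq> x \<longrightarrow> g \<sqsubseteq> x}"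
  have "?S = M"
  proof (rule maximal)
    show "M \<subseteq> ?S" using least by blast
    show "x \<sqinter> y \<in> ?S" if "x \<in> ?S" "y \<in> ?S" for x y
      using that by simp
    show "x \<squnion> y \<in> ?S" if "x \<in> ?S" "y \<in> ?S" for x y
      using that prime[of x y] by (auto intro: le_supI1 le_supI2)
    show "a \<notin> ?S" using a g by (auto dest: order.antisym)
  qed
  with x show ?thesis by blast
qed

end

lemma card_ge_2E:
  assumes "2 \<le> card A"
  obtains x y where "x \<in> A" "y \<in> A" "x \<noteq> y"
proof -
  obtain B where "B \<subseteq> A" "card B = 2"
    using obtain_subset_with_card_n[OF assms] by metis
  with that show thesis by (auto simp: card_2_iff)
qed

lemma two_atoms_meet:
  assumes "card (atoms :: 'a::bounded_lattice set) \<ge> 2"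
  obtains c d :: "'a::bounded_lattice" where "c \<noteq> bot" "d \<noteq> bot" "inf c d = bot"
proof -
  obtain c d :: "'a" where cd: "c \<in> atoms" "d \<in> atoms" "c \<noteq> d"
    using assms by (auto elim!: card_ge_2E)
  \<comment> \<open>If the meet equalled both atoms, they would coincide.\<close>
  have "inf c d < c \<or> inf c d < d"
    using cd(3) by (metis inf_le1 inf_le2 order.not_eq_order_implies_strict)
  then have "\<not> bot < inf c d" using cd(1,2) unfolding atoms_def covers_def by blast
  then have "inf c d = bot" using bot.not_eq_extremum by blast
  moreover have "c \<noteq> bot" "d \<noteq> bot" using cd(1,2) by (auto simp: atoms_def covers_def)
  ultimately show thesis using that by blast
qed

lemma two_coatoms_join:
  assumes "card (coatoms :: 'a::bounded_lattice set) \<ge> 2"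
  obtains c d :: "'a::bounded_lattice" where "c \<noteq> top" "d \<noteq> top" "sup c d = top"
proof -
  obtain c d :: "'a" where cd: "c \<in> coatoms" "d \<in> coatoms" "c \<noteq> d"
    using assms by (auto elim!: card_ge_2E)
  have "c < sup c d \<or> d < sup c d"
    using cd(3) by (metis sup_ge1 sup_ge2 order.not_eq_order_implies_strict)
  then have "\<not> sup c d < top" using cd(1,2) unfolding coatoms_def covers_def by blast
  then have "sup c d = top" using top.not_eq_extremum by blast
  moreover have "c \<noteq> top" "d \<noteq> top" using cd(1,2) by (auto simp: coatoms_def covers_def)
  ultimately show thesis using that by blast
qed

lemma finite_maximal_sublatticeI:
  fixes M :: "'a::{finite,lattice} set"
  assumes "maximal_sublattice M"
  shows "finite_maximal_sublattice inf (\<le>) (<) sup M"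
proof
  show "S = M" if "M \<subseteq> S" "\<And>x y. x \<in> S \<Longrightarrow> y \<in> S \<Longrightarrow> inf x y \<in> S"
    "\<And>x y. x \<in> S \<Longrightarrow> y \<in> S \<Longrightarrow> sup x y \<in> S" "z \<notin> S" for S z
  proof -
    have "M \<noteq> {}"
      using assms by (simp add: maximal_sublattice_def proper_sublattice_def sublattice_def)
    \<comment> \<open>The locale's closure conditions allow the empty set, so nonemptiness has to be
      inherited from \<open>M\<close>.\<close>
    with that(1) have "S \<noteq> {}" by blast
    with that(2-4) have "proper_sublattice S"
      unfolding proper_sublattice_def sublattice_def by auto
    with assms that(1) show ?thesis unfolding maximal_sublattice_def by blast
  qed
qed (use assms in \<open>auto simp: maximal_sublattice_def proper_sublattice_def sublattice_def\<close>)

theorem theorem5p1: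
  fixes M C :: "'a::{finite,bounded_lattice} set"
  assumes "semidistributive TYPE('a)"
    and "card (atoms :: 'a set) \<ge> 2"
    and "card (coatoms :: 'a set) \<ge> 2"
    and "maximal_sublattice M"
    and "C = UNIV - M"
    and "has_greatest C \<or> has_least C \<or> C \<inter> atoms \<noteq> {} \<or> C \<inter> coatoms \<noteq> {}"
  shows "is_interval C"
proof -
  interpret P: finite_maximal_sublattice inf "(\<le>)" "(<)" sup M
    using assms(4) by (rule finite_maximal_sublatticeI)
  \<comment> \<open>In this copy \<open>jsd\<close> plays the part of \<open>msd\<close>, a greatest
    element that of a least one, and coatoms that of atoms.\<close>
  interpret D: finite_maximal_sublattice sup "(\<ge>)" "(>)" inf M
    by (rule P.dual)
  have msd: "inf x (sup y z) = inf x y" if "inf x y = inf x z" for x y z :: 'a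
    using assms(1) that unfolding semidistributive_def meet_semidistributive_def by blast
  have jsd: "sup x (inf y z) = sup x y" if "sup x y = sup x z" for x y z :: 'a
    using assms(1) that unfolding semidistributive_def join_semidistributive_def by blast
  have top: "top \<in> M"
    by (rule two_coatoms_join[OF assms(3)]) (rule P.sup_reducible_top_mem[OF top_greatest])
  have bot: "bot \<in> M"
    by (rule two_atoms_meet[OF assms(2)]) (rule D.sup_reducible_top_mem[OF bot_least])
  have least: "is_interval C" if "has_least C"
  proof -
    obtain l where "l \<notin> M" "\<And>x. x \<notin> M \<Longrightarrow> l \<le> x"
      using \<open>has_least C\<close> assms(5) unfolding has_least_def by auto
    from P.complement_with_least_is_interval[OF msd this top top_greatest]
    show ?thesis unfolding is_interval_def assms(5) atLeastAtMost_def atLeast_def atMost_def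
      by (auto simp: Collect_conj_eq)
  qed
  have greatest: "is_interval C" if "has_greatest C"
  proof -
    obtain l where "l \<notin> M" "\<And>x. x \<notin> M \<Longrightarrow> x \<le> l"
      using \<open>has_greatest C\<close> assms(5) unfolding has_greatest_def by auto
    from D.complement_with_least_is_interval[OF jsd this bot bot_least]
    show ?thesis unfolding is_interval_def assms(5) atLeastAtMost_def atLeast_def atMost_def
      by (auto simp: Collect_conj_eq Int_commute)
  qed
  have "has_least C" if a: "a \<in> C" "a \<in> atoms" for a
  proof -
    have "bot < a" "\<not> (bot < x \<and> x < a)" for x
      using a(2) unfolding atoms_def covers_def by blast+
    then have "bot \<noteq> a" "\<And>x. x \<le> a \<Longrightarrow> x = bot \<or> x = a"
      unfolding bot.not_eq_extremum[symmetric] order.order_iff_strict by blast+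
    moreover have "a \<notin> M" using a(1) assms(5) by blast
    ultimately have "a \<le> x" if "x \<notin> M" for x
      using P.atom_outside_is_least[OF msd bot_least _ _ _ top top_greatest that] by blast
    then show ?thesis using a(1) assms(5) unfolding has_least_def by auto
  qed
  moreover have "has_greatest C" if a: "a \<in> C" "a \<in> coatoms" for a
  proof -
    have "a < top" "\<not> (a < x \<and> x < top)" for x
      using a(2) unfolding coatoms_def covers_def by blast+
    then have "top \<noteq> a" "\<And>x. a \<le> x \<Longrightarrow> x = top \<or> x = a"
      unfolding top.not_eq_extremum[symmetric] order.order_iff_strict by blast+
    moreover have "a \<notin> M" using a(1) assms(5) by blast
    ultimately have "x \<le> a" if "x \<notin> M" for x
      using D.atom_outside_is_least[OF jsd top_greatest _ _ _ bot bot_least that] by blast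
    then show ?thesis using a(1) assms(5) unfolding has_greatest_def by auto
  qed
  ultimately show ?thesis using assms(6) least greatest by blast
qed

end
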